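(* Let $f\in\mathrm{TotP}$ and let $s:\mathbb{N}\to\mathbb{N}$ be a positive function with $s(n)=O(2^n)$. Then there is a deterministic algorithm which, on input $x\in\{0,1\}^n$ (given the value $s(n)$), decides whether $f(x)\le s(n)$ in time $O(s(n)\cdot\mathrm{poly}(n))$.
   Context: $\mathrm{TotP}$ is the class of functions $f:\{0,1\}^*\to\mathbb{N}$ for which there is a nondeterministic polynomial-time Turing machine $M$ such that for every input $x$ the number of all computation paths of $M$ on $x$ equals $f(x)+1$. Such an $M$ can be chosen binary (exactly two choices at each nondeterministic step), so that its computation tree on $x$ has exactly $f(x)$ internal nodes. *)

theory Defs
  imports Complex_Main "HOL-Library.Landau_Symbols" "HOL-Computational_Algebra.Polynomial"
begin

text \<open>
  Multi-tape Turing machines with two-way infinite tapes. States are natural numbers;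
  \<open>Work\<close> supplies arbitrarily many additional tape symbols.
\<close>

datatype symbol = Blank | Bit bool | Sep | Work nat

datatype move = Move_Left | Stay | Move_Right

record transition =
  source :: nat
  reads :: "symbol list"
  target :: nat
  writes :: "symbol list"
  moves :: "move list"

record tm =
  ntapes :: nat
  states :: "nat set"
  alphabet :: "symbol set"
  start :: nat
  accepting :: "nat set"
  transitions :: "transition set"

definition wf_transition :: "tm \<Rightarrow> transition \<Rightarrow> bool" where
  "wf_transition M t \<longleftrightarrow>
     source t \<in> states M \<and> target t \<in> states M \<and>
     length (reads t) = ntapes M \<and> set (reads t) \<subseteq> alphabet M \<and>
     length (writes t) = ntapes M \<and> set (writes t) \<subseteq> alphabet M \<and>
     length (moves t) = ntapes M"

definition wf_tm :: "tm \<Rightarrow> bool" where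
  "wf_tm M \<longleftrightarrow>
     1 \<le> ntapes M \<and>
     finite (states M) \<and> start M \<in> states M \<and> accepting M \<subseteq> states M \<and>
     finite (alphabet M) \<and> {Blank, Bit False, Bit True, Sep} \<subseteq> alphabet M \<and>
     (\<forall>t \<in> transitions M. wf_transition M t)"

definition deterministic :: "tm \<Rightarrow> bool" where
  "deterministic M \<longleftrightarrow>
     (\<forall>t \<in> transitions M. \<forall>t' \<in> transitions M.
        source t = source t' \<and> reads t = reads t' \<longrightarrow> t = t')"

text \<open>A tape is its content together with the head position.\<close>

type_synonym tape = "(int \<Rightarrow> symbol) \<times> int"
type_synonym config = "nat \<times> tape list"

fun scanned :: "tape \<Rightarrow> symbol" where
  "scanned (u, h) = u h"

fun shift :: "move \<Rightarrow> int" where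
  "shift Move_Left = -1"
| "shift Stay = 0"
| "shift Move_Right = 1"

fun update_tape :: "tape \<Rightarrow> symbol \<times> move \<Rightarrow> tape" where
  "update_tape (u, h) (a, m) = (u(h := a), h + shift m)"

definition enabled :: "transition \<Rightarrow> config \<Rightarrow> bool" where
  "enabled t c \<longleftrightarrow> source t = fst c \<and> reads t = map scanned (snd c)"

definition fire :: "transition \<Rightarrow> config \<Rightarrow> config" where
  "fire t c = (target t, map2 update_tape (snd c) (zip (writes t) (moves t)))"

definition halted :: "tm \<Rightarrow> config \<Rightarrow> bool" where
  "halted M c \<longleftrightarrow> (\<forall>t \<in> transitions M. \<not> enabled t c)"

definition initial :: "tm \<Rightarrow> symbol list \<Rightarrow> config" where
  "initial M w =
     (start M,
      (\<lambda>i. if 0 \<le> i \<and> nat i < length w then w ! nat i else Blank, 0)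
      # replicate (ntapes M - 1) (\<lambda>_. Blank, 0))"

text \<open>A (possibly partial) run is recorded as the sequence of the transitions taken.\<close>

inductive run :: "tm \<Rightarrow> config \<Rightarrow> transition list \<Rightarrow> config \<Rightarrow> bool" for M where
  run_Nil: "run M c [] c"
| run_Cons: "t \<in> transitions M \<Longrightarrow> enabled t c \<Longrightarrow> run M (fire t c) ts c' \<Longrightarrow> run M c (t # ts) c'"

definition computation_paths :: "tm \<Rightarrow> symbol list \<Rightarrow> transition list set" where
  "computation_paths M w = {ts. \<exists>c. run M (initial M w) ts c \<and> halted M c}"

definition poly_time :: "tm \<Rightarrow> bool" where
  "poly_time M \<longleftrightarrow>
     (\<exists>p :: nat poly. \<forall>(x :: bool list) ts c.
        run M (initial M (map Bit x)) ts c \<longrightarrow> length ts \<le> poly p (length x))"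

definition TotP :: "(bool list \<Rightarrow> nat) set" where
  "TotP = {f. \<exists>M. wf_tm M \<and> poly_time M \<and>
                (\<forall>x. card (computation_paths M (map Bit x)) = f x + 1)}"

text \<open>
  The deterministic machine \<open>M\<close> decides \<open>P\<close>, with instance \<open>x\<close> presented on the input tape as
  \<open>enc x\<close>, halting after at most \<open>t x\<close> steps.
\<close>

definition decides_within :: "tm \<Rightarrow> ('a \<Rightarrow> symbol list) \<Rightarrow> ('a \<Rightarrow> bool) \<Rightarrow> ('a \<Rightarrow> nat) \<Rightarrow> bool" where
  "decides_within M enc P t \<longleftrightarrow>
     wf_tm M \<and> deterministic M \<and>
     (\<forall>x. \<exists>ts q tps. run M (initial M (enc x)) ts (q, tps) \<and> halted M (q, tps) \<and>
        length ts \<le> t x \<and> (q \<in> accepting M \<longleftrightarrow> P x))"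

text \<open>Binary representation, most significant bit first.\<close>

fun binary :: "nat \<Rightarrow> bool list" where
  "binary n = (if n = 0 then [] else binary (n div 2) @ [odd n])"

declare binary.simps [simp del]

definition encode_pair :: "bool list \<Rightarrow> nat \<Rightarrow> symbol list" where
  "encode_pair x m = map Bit x @ [Sep] @ map Bit (binary m)"

end

theory Submission imports Defs "HOL-Library.Countable" begin

text \<open>
  A deterministic machine walks through the computation tree of the given machine depth first. It
  records the transitions taken on a stack, from which every simulated step can be undone exactly,
  and it starts with \<open>s n\<close> on a binary counter. Whenever it moves on to a child that is not the
  first child of its node, it decrements the counter. Their number is (number of leaves)
  \<open>- 1 = f x\<close>, so the counter survives the whole walk if and only if \<open>f x \<le> s n\<close>; on underflow
  the machine stops. Between two decrements only polynomially many steps are made, because the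
  depth of the tree is polynomial and \<open>s n = O(2 ^ n)\<close> bounds the width of the counter by
  \<open>n + O(1)\<close>.
\<close>

section \<open>Computation trees\<close>

text \<open>There are \<open>leaves - 1\<close> non-first children because in a finite tree the sum
  of (number of children - 1) over the internal nodes is the number of leaves minus one. This holds
  for nodes of any degree, so \<open>M\<close> is simulated without first being made binary, and
  steps without a choice cost nothing on the counter. A stack of transitions suffices for
  backtracking: a fired transition lists in \<open>reads\<close> precisely the symbols that it
  overwrote, and its moves can be reversed. The tapes thus return literally to their former
  contents, and one invariant serves every child. The obstacle is the time bound. The tree may be
  exponentially larger than \<open>s n\<close>, so the search must stop after about
  \<open>s n + 1\<close> leaves with only polynomial work per leaf. Hence time is charged to leaves:
  each level of the tree adds a fixed amount to the price of a leaf, which makes the price linear in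
  depth times counter width. The machine carries no clock: the polynomial bound enters only the
  analysis, and the counter is copied from the input.\<close>

definition paths_from :: "tm \<Rightarrow> config \<Rightarrow> transition list set" where
  "paths_from M c = {ts. \<exists>c'. run M c ts c' \<and> halted M c'}"

definition leaves :: "tm \<Rightarrow> config \<Rightarrow> nat" where
  "leaves M c = card (paths_from M c)"

definition depth_le :: "tm \<Rightarrow> config \<Rightarrow> nat \<Rightarrow> bool" where
  "depth_le M c d \<longleftrightarrow> (\<forall>ts c'. run M c ts c' \<longrightarrow> length ts \<le> d)"

text \<open>Well-formedness confines each of the five components of a transition to a finite set.
  Finiteness allows the transitions to be listed, with list positions as names in states and stack
  symbols.\<close>

lemma finite_transitions:
  assumes "wf_tm M"
  shows "finite (transitions M)"
proof -
  let ?S = "{xs. set xs \<subseteq> alphabet M \<and> length xs = ntapes M}"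
  let ?V = "{ms. set ms \<subseteq> {Move_Left, Stay, Move_Right} \<and> length ms = ntapes M}"
  let ?P = "states M \<times> ?S \<times> states M \<times> ?S \<times> ?V"
  have "finite ?S" "finite ?V" "finite (states M)"
    using assms by (auto simp: wf_tm_def intro!: finite_lists_length_eq)
  then have fin: "finite ?P"
    by (intro finite_cartesian_product)
  have V: "set ms \<subseteq> {Move_Left, Stay, Move_Right}" for ms
    using move.exhaust by auto
  have "t \<in> (\<lambda>(a, b, c, d, e). \<lparr>source = a, reads = b, target = c, writes = d, moves = e\<rparr>) ` ?P"
    if "t \<in> transitions M" for t
    using assms that V
    by (intro image_eqI[of _ _ "(source t, reads t, target t, writes t, moves t)"])
       (auto simp: wf_tm_def wf_transition_def)
  then have "transitions M \<subseteq> (\<lambda>(a, b, c, d, e).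
      \<lparr>source = a, reads = b, target = c, writes = d, moves = e\<rparr>) ` ?P" by blast
  then show ?thesis using fin by (meson finite_imageI finite_subset)
qed

lemma run_Cons_iff:
  "run M c (t # ts) c' \<longleftrightarrow> t \<in> transitions M \<and> enabled t c \<and> run M (fire t c) ts c'"
  by (auto intro: run.intros elim: run.cases)

lemma run_Nil_iff: "run M c [] c' \<longleftrightarrow> c' = c"
  by (auto intro: run.intros elim: run.cases)

lemma set_run_subset: "run M c ts c' \<Longrightarrow> set ts \<subseteq> transitions M"
  by (induction rule: run.induct) auto

text \<open>The descent to a child in inductions on the depth bound; since \<open>d\<close>
  determines \<open>d'\<close>, one bound serves all children.\<close>

lemma depth_le_fire:
  assumes "depth_le M c d" "t \<in> transitions M" "enabled t c"
  obtains d' where "d = Suc d'" "depth_le M (fire t c) d'"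
proof -
  have *: "Suc (length ts) \<le> d" if "run M (fire t c) ts c'" for ts c'
  proof -
    have "run M c (t # ts) c'" using assms that by (intro run_Cons)
    with assms(1) have "length (t # ts) \<le> d" unfolding depth_le_def by blast
    then show ?thesis by simp
  qed
  have "Suc 0 \<le> d" using *[OF run_Nil] by simp
  then obtain d' where "d = Suc d'" by (cases d) auto
  with * that show thesis by (auto simp: depth_le_def)
qed

text \<open>As \<open>card\<close> of an infinite set is 0, \<open>leaves\<close> is a genuine count
  only once a depth bound is available.\<close>

lemma finite_paths_from:
  assumes "wf_tm M" "depth_le M c d"
  shows "finite (paths_from M c)"
proof (rule finite_subset)
  show "paths_from M c \<subseteq> {ts. set ts \<subseteq> transitions M \<and> length ts \<le> d}"
    using assms(2) set_run_subset unfolding paths_from_def depth_le_def by blast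
  show "finite {ts. set ts \<subseteq> transitions M \<and> length ts \<le> d}"
    using finite_transitions[OF assms(1)] by (rule finite_lists_length_le)
qed

lemma paths_from_halted: "halted M c \<Longrightarrow> paths_from M c = {[]}"
proof -
  assume h: "halted M c"
  have "ts = []" if "run M c ts c'" for ts c'
    using h that by (cases ts) (auto simp: run_Cons_iff halted_def)
  moreover have "run M c [] c" by (rule run_Nil)
  ultimately show ?thesis using h unfolding paths_from_def by blast
qed

lemma leaves_halted: "halted M c \<Longrightarrow> leaves M c = 1"
  by (simp add: leaves_def paths_from_halted)

lemma paths_from_not_halted:
  assumes "\<not> halted M c"
  shows "paths_from M c =
    (\<Union>t \<in> {t \<in> transitions M. enabled t c}. (#) t ` paths_from M (fire t c))" (is "?L = ?R")
proof (rule set_eqI)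
  fix ts
  show "ts \<in> ?L \<longleftrightarrow> ts \<in> ?R"
    using assms by (cases ts) (auto simp: paths_from_def run_Cons_iff run_Nil_iff)
qed

text \<open>The first transition splits the paths into disjoint classes, one per child, and
  prefixing it is injective.\<close>

lemma leaves_not_halted:
  assumes "wf_tm M" "depth_le M c d" "\<not> halted M c"
  shows "leaves M c = (\<Sum>t \<in> {t \<in> transitions M. enabled t c}. leaves M (fire t c))"
proof -
  have fin: "finite (paths_from M (fire t c))" if "t \<in> transitions M" "enabled t c" for t
    using depth_le_fire[OF assms(2) that] finite_paths_from[OF assms(1)] by metis
  have "leaves M c = (\<Sum>t \<in> {t \<in> transitions M. enabled t c}. card ((#) t ` paths_from M (fire t c)))"
    unfolding leaves_def paths_from_not_halted[OF assms(3)]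
    using finite_transitions[OF assms(1)] fin
    by (intro card_UN_disjoint) auto
  then show ?thesis by (simp add: leaves_def card_image)
qed

text \<open>The accounting rests on this: every sibling contributes a leaf, which pays for the
  overhead of visiting it and which pushes the count past the budget when the counter
  underflows.\<close>

lemma leaves_pos:
  assumes "wf_tm M" "depth_le M c d"
  shows "0 < leaves M c"
  using assms(2)
proof (induction d arbitrary: c rule: less_induct)
  case (less d)
  show ?case
  proof (cases "halted M c")
    case False
    then obtain t where t: "t \<in> transitions M" "enabled t c" by (auto simp: halted_def)
    from depth_le_fire[OF less.prems t] obtain d' where "d = Suc d'" "depth_le M (fire t c) d'" .
    with less.IH[of d' "fire t c"] have "0 < leaves M (fire t c)" by simp
    with t finite_transitions[OF assms(1)] show ?thesis
      unfolding leaves_not_halted[OF assms(1) less.prems False]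
      by (intro sum_pos2[of _ t]) auto
  qed (simp add: leaves_halted)
qed

section \<open>Tapes and binary numerals\<close>

definition cells :: "symbol list \<Rightarrow> int \<Rightarrow> symbol" where
  "cells w = (\<lambda>i. if 0 \<le> i \<and> nat i < length w then w ! nat i else Blank)"

lemma cells_middle: "cells (xs @ a # ys) (int (length xs)) = a"
  by (simp add: cells_def)

lemma cells_middle_update:
  "(cells (xs @ a # ys))(int (length xs) := b) = cells (xs @ b # ys)"
  by (auto simp: cells_def fun_eq_iff nth_append nth_Cons' split: if_splits)

lemma cells_end: "cells xs (int (length xs)) = Blank"
  by (simp add: cells_def)

lemma cells_end_update: "(cells xs)(int (length xs) := b) = cells (xs @ [b])"
  by (auto simp: cells_def fun_eq_iff nth_append nth_Cons' split: if_splits)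

lemma cells_negative: "i < 0 \<Longrightarrow> cells xs i = Blank"
  by (simp add: cells_def)

text \<open>Erased cells cannot be told from untouched ones, so after the preparation the simulated
  tape is exactly the initial tape of \<open>M\<close>.\<close>

lemma cells_append_blanks: "cells (xs @ replicate m Blank) = cells xs"
  by (auto simp: cells_def fun_eq_iff nth_append)

text \<open>Horner evaluation, most significant bit first. Leading zeros are allowed, so a counter
  can keep its width while it is decremented.\<close>

definition bits_val :: "bool list \<Rightarrow> nat" where
  "bits_val bs = foldl (\<lambda>v b. 2 * v + of_bool b) 0 bs"

lemma bits_val_Nil [simp]: "bits_val [] = 0"
  by (simp add: bits_val_def)

lemma bits_val_snoc [simp]: "bits_val (bs @ [b]) = 2 * bits_val bs + of_bool b"
  by (simp add: bits_val_def)

lemma bits_val_binary: "bits_val (binary n) = n"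
proof (induction n rule: less_induct)
  case (less n)
  show ?case
    using less[of "n div 2"]
    by (cases "n = 0") (auto simp: binary.simps[of n] binary.simps[of 0] elim: oddE)
qed

lemma length_binary: "n > 0 \<Longrightarrow> 2 ^ length (binary n) \<le> 2 * n"
proof (induction n rule: less_induct)
  case (less n)
  show ?case
  proof (cases "n = 1")
    case True
    then show ?thesis by (simp add: binary.simps)
  next
    case False
    then have "2 ^ length (binary (n div 2)) \<le> 2 * (n div 2)" using less by auto
    then show ?thesis using less.prems by (simp add: binary.simps[of n])
  qed
qed

lemma bits_val_eq_0: "bits_val bs = 0 \<Longrightarrow> bs = replicate (length bs) False"
proof (induction bs rule: rev_induct)
  case (snoc b bs)
  then have "\<not> b" "bs = replicate (length bs) False" by (auto split: if_splits)
  then show ?case by (metis (full_types) length_append_singleton replicate_Suc replicate_append_same)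
qed simp

text \<open>Borrow propagation: the last \<open>True\<close> becomes \<open>False\<close>, and the
  \<open>m\<close> zeros behind it become ones. Induction from the right fits the recursion of
  \<open>bits_val_snoc\<close>.\<close>

lemma bits_val_pred:
  assumes "bits_val bs > 0"
  obtains pre m where "bs = pre @ True # replicate m False"
    "Suc (bits_val (pre @ False # replicate m True)) = bits_val bs"
proof -
  have "\<exists>pre m. bs = pre @ True # replicate m False \<and>
    Suc (bits_val (pre @ False # replicate m True)) = bits_val bs"
    using assms
  proof (induction bs rule: rev_induct)
    case (snoc b bs)
    show ?case
    proof (cases b)
      case True
      then show ?thesis by (intro exI[of _ bs] exI[of _ 0]) simp
    next
      case False
      with snoc obtain pre m where *: "bs = pre @ True # replicate m False"
        "Suc (bits_val (pre @ False # replicate m True)) = bits_val bs" by auto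
      have "bits_val (pre @ False # replicate (Suc m) True) =
        bits_val ((pre @ False # replicate m True) @ [True])"
        by (simp add: replicate_append_same)
      also have "\<dots> = 2 * bits_val (pre @ False # replicate m True) + 1"
        by (subst bits_val_snoc) simp
      finally have "Suc (bits_val (pre @ False # replicate (Suc m) True)) = bits_val (bs @ [b])"
        using *(2) False by simp
      then show ?thesis using * False
        by (intro exI[of _ pre] exI[of _ "Suc m"]) (simp add: replicate_append_same)
    qed
  qed simp
  then show thesis using that by blast
qed

section \<open>The depth-first search machine\<close>

datatype dstate = Init | Scan | Copy | Return | Down nat | Fire nat | Back | Pop | Undo nat
  | DecL nat | DecR nat | Accept | Reject

text \<open>States of a \<open>tm\<close> are natural numbers; countability supplies the injective
  numbering \<open>to_nat\<close>.\<close>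

instance dstate :: countable
  by countable_datatype

fun inverse_move :: "move \<Rightarrow> move" where
  "inverse_move Move_Left = Move_Right"
| "inverse_move Stay = Stay"
| "inverse_move Move_Right = Move_Left"

definition idle :: "symbol list \<Rightarrow> (symbol \<times> move) list" where
  "idle r = map (\<lambda>a. (a, Stay)) r"

text \<open>The simulated input tape has to stay in front, since \<^const>\<open>initial\<close> puts the input there.\<close>

definition mix :: "'a list \<Rightarrow> 'a \<Rightarrow> 'a \<Rightarrow> 'a list" where
  "mix ms h c = hd ms # h # c # tl ms"

lemma mix_inject:
  "ms \<noteq> [] \<Longrightarrow> ms' \<noteq> [] \<Longrightarrow> mix ms h c = mix ms' h' c' \<longleftrightarrow> ms = ms' \<and> h = h' \<and> c = c'"
  by (cases ms; cases ms') (auto simp: mix_def)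

lemma length_mix: "ms \<noteq> [] \<Longrightarrow> length (mix ms h c) = length ms + 2"
  by (cases ms) (auto simp: mix_def)

lemma set_mix: "ms \<noteq> [] \<Longrightarrow> set (mix ms h c) = set ms \<union> {h, c}"
  by (cases ms) (auto simp: mix_def)

lemma map_mix: "ms \<noteq> [] \<Longrightarrow> map g (mix ms h c) = mix (map g ms) (g h) (g c)"
  by (cases ms) (auto simp: mix_def)

lemma zip_mix:
  "ms \<noteq> [] \<Longrightarrow> ns \<noteq> [] \<Longrightarrow> zip (mix ms h c) (mix ns h' c') = mix (zip ms ns) (h, h') (c, c')"
  by (cases ms; cases ns) (auto simp: mix_def)

lemma map2_update_idle: "map2 update_tape tps (idle (map scanned tps)) = tps"
  unfolding idle_def by (induction tps) auto

lemma update_scanned_Stay [simp]: "update_tape tp (scanned tp, Stay) = tp"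
  by (cases tp) simp

text \<open>A list in place of the set orders the children of each node: it determines which child
  is first and which sibling comes next.\<close>

locale path_search =
  fixes M :: tm and trs :: "transition list"
  assumes wf: "wf_tm M" and distinct_trs: "distinct trs" and set_trs: "set trs = transitions M"
begin

definition matches :: "nat \<Rightarrow> symbol list \<Rightarrow> nat \<Rightarrow> bool" where
  "matches q r j \<longleftrightarrow> source (trs ! j) = q \<and> reads (trs ! j) = r"

text \<open>Started at 0 it finds the first child, started at \<open>Suc j\<close> the next sibling
  of child \<open>j\<close>; \<open>None\<close> means a leaf in the first case and the last sibling
  in the second.\<close>

definition next_match :: "nat \<Rightarrow> nat \<Rightarrow> symbol list \<Rightarrow> nat option" where
  "next_match i q r = find (matches q r) [i..<length trs]"

text \<open>
  An action consists of the new state and what to do on the tapes of the simulated machine, on the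
  history tape and on the counter tape. On the history tape, \<open>Sep\<close> marks the bottom of the stack and
  \<open>Work j\<close> stands for the transition \<open>trs ! j\<close>; the head is on the first free cell. The head of
  the counter tape is just behind the least significant bit. A simulated step is undone in two
  steps, because a machine writes before it moves.
\<close>

fun act :: "dstate \<Rightarrow> symbol list \<Rightarrow> symbol \<Rightarrow> symbol \<Rightarrow>
    (dstate \<times> (symbol \<times> move) list \<times> (symbol \<times> move) \<times> (symbol \<times> move)) option" where
  "act Init r h c = Some (Scan, idle r, (Sep, Stay), (c, Stay))"
| "act Scan r h c = Some (
     if hd r = Sep then (Copy, (Blank, Move_Right) # idle (tl r), (h, Move_Right), (c, Stay))
     else (Scan, (hd r, Move_Right) # idle (tl r), (h, Move_Right), (c, Stay)))"
| "act Copy r h c = Some (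
     if hd r = Blank then (Return, idle r, (h, Stay), (c, Stay))
     else (Copy, (Blank, Move_Right) # idle (tl r), (h, Move_Right), (hd r, Move_Right)))"
| "act Return r h c = Some (
     if h = Sep then (Down (start M), idle r, (h, Move_Right), (c, Stay))
     else (Return, (hd r, Move_Left) # idle (tl r), (h, Move_Left), (c, Stay)))"
| "act (Down q) r h c = Some (
     case next_match 0 q r of None \<Rightarrow> (Back, idle r, (h, Stay), (c, Stay))
     | Some j \<Rightarrow> (Fire j, idle r, (h, Stay), (c, Stay)))"
| "act (Fire j) r h c = Some (Down (target (trs ! j)),
     zip (writes (trs ! j)) (moves (trs ! j)), (Work j, Move_Right), (c, Stay))"
| "act Back r h c = Some (Pop, idle r, (h, Move_Left), (c, Stay))"
| "act Pop r h c = (case h of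
       Sep \<Rightarrow> Some (Accept, idle r, (h, Stay), (c, Stay))
     | Work j \<Rightarrow> if j < length trs
         then Some (Undo j, zip r (map inverse_move (moves (trs ! j))), (Blank, Stay), (c, Stay))
         else None
     | _ \<Rightarrow> None)"
| "act (Undo j) r h c = Some (
     case next_match (Suc j) (source (trs ! j)) (reads (trs ! j)) of
       None \<Rightarrow> (Back, idle (reads (trs ! j)), (h, Stay), (c, Stay))
     | Some i \<Rightarrow> (DecL i, idle (reads (trs ! j)), (h, Stay), (c, Move_Left)))"
| "act (DecL i) r h c = Some (
     if c = Bit True then (DecR i, idle r, (h, Stay), (Bit False, Move_Right))
     else if c = Bit False then (DecL i, idle r, (h, Stay), (Bit True, Move_Left))
     else (Reject, idle r, (h, Stay), (c, Stay)))"
| "act (DecR i) r h c = Some (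
     if c = Blank then (Fire i, idle r, (h, Stay), (c, Stay))
     else (DecR i, idle r, (h, Stay), (c, Move_Right)))"
| "act Accept r h c = None"
| "act Reject r h c = None"

text \<open>The search is analysed on symbolic states and separated tape groups;
  \<open>run_machine\<close> transfers the result to the numbered and mixed form.\<close>

definition step :: "dstate \<times> tape list \<times> tape \<times> tape \<Rightarrow> dstate \<times> tape list \<times> tape \<times> tape \<Rightarrow> bool" where
  "step = (\<lambda>(q, tps, ht, ct) c'. \<exists>q' as ah ac.
     act q (map scanned tps) (scanned ht) (scanned ct) = Some (q', as, ah, ac) \<and>
     c' = (q', map2 update_tape tps as, update_tape ht ah, update_tape ct ac))"

definition reach :: "nat \<Rightarrow> dstate \<times> tape list \<times> tape \<times> tape \<Rightarrow> dstate \<times> tape list \<times> tape \<times> tape \<Rightarrow> bool"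
  where "reach n c c' \<longleftrightarrow> (\<exists>m\<le>n. (step ^^ m) c c')"

lemma stepI:
  assumes "act q (map scanned tps) (scanned ht) (scanned ct) = Some (q', as, ah, ac)"
    and "tps' = map2 update_tape tps as" "ht' = update_tape ht ah" "ct' = update_tape ct ac"
  shows "step (q, tps, ht, ct) (q', tps', ht', ct')"
  using assms unfolding step_def by blast

lemma reach_refl: "reach n c c"
  unfolding reach_def by (rule exI[of _ 0]) simp

lemma reach_step: "step c c' \<Longrightarrow> reach n c' c'' \<Longrightarrow> reach (Suc n) c c''"
  unfolding reach_def by (meson Suc_le_mono relpowp_Suc_I2)

lemma reach_trans: "reach m c c' \<Longrightarrow> reach n c' c'' \<Longrightarrow> reach (m + n) c c''"
  unfolding reach_def by (metis add_mono relpowp_trans)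

lemma reach_mono: "reach m c c' \<Longrightarrow> m \<le> n \<Longrightarrow> reach n c c'"
  unfolding reach_def by (meson le_trans)

subsection \<open>Realization as a Turing machine\<close>

definition dstates :: "dstate set" where
  "dstates = {Init, Scan, Copy, Return, Back, Pop, Accept, Reject} \<union> Down ` states M \<union>
     (\<Union>j<length trs. {Fire j, Undo j, DecL j, DecR j})"

text \<open>Some \<open>Work j\<close> may already belong to \<open>alphabet M\<close>; this is
  harmless, because stack symbols are interpreted on the history tape only.\<close>

definition symbols :: "symbol set" where
  "symbols = alphabet M \<union> Work ` {..<length trs}"

definition transition_of :: "dstate \<Rightarrow> symbol list \<Rightarrow> symbol \<Rightarrow> symbol \<Rightarrow>
    dstate \<times> (symbol \<times> move) list \<times> (symbol \<times> move) \<times> (symbol \<times> move) \<Rightarrow> transition" where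
  "transition_of q r h c = (\<lambda>(q', as, ah, ac).
     \<lparr>source = to_nat q, reads = mix r h c, target = to_nat q',
      writes = mix (map fst as) (fst ah) (fst ac), moves = mix (map snd as) (snd ah) (snd ac)\<rparr>)"

definition machine :: tm where
  "machine = \<lparr>ntapes = ntapes M + 2, states = to_nat ` dstates, alphabet = symbols,
     start = to_nat Init, accepting = {to_nat Accept},
     transitions = {transition_of q r h c a | q r h c a. q \<in> dstates \<and> set r \<subseteq> symbols \<and>
       length r = ntapes M \<and> h \<in> symbols \<and> c \<in> symbols \<and> act q r h c = Some a}\<rparr>"

lemma transitions_machine:
  "t \<in> transitions machine \<longleftrightarrow> (\<exists>q r h c a. t = transition_of q r h c a \<and> q \<in> dstates \<and>
     set r \<subseteq> symbols \<and> length r = ntapes M \<and> h \<in> symbols \<and> c \<in> symbols \<and> act q r h c = Some a)"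
  by (auto simp: machine_def)

lemma trs_nth:
  assumes "j < length trs"
  shows "trs ! j \<in> transitions M" "wf_transition M (trs ! j)"
  using assms wf set_trs nth_mem by (auto simp: wf_tm_def)

lemma next_match_SomeD:
  assumes "next_match i q r = Some j"
  shows "i \<le> j" "j < length trs" "matches q r j" "\<And>l. i \<le> l \<Longrightarrow> l < j \<Longrightarrow> \<not> matches q r l"
proof -
  from assms obtain n where n: "n < length trs - i" "matches q r (i + n)" "j = i + n"
    "\<forall>m<n. \<not> matches q r (i + m)" by (auto simp: next_match_def find_Some_iff)
  then show "i \<le> j" "j < length trs" "matches q r j" by auto
  show "\<not> matches q r l" if "i \<le> l" "l < j" for l
    using that n(3,4) by (metis le_Suc_ex nat_add_left_cancel_less)
qed

lemma next_match_NoneD: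
  "next_match i q r = None \<Longrightarrow> i \<le> l \<Longrightarrow> l < length trs \<Longrightarrow> \<not> matches q r l"
  by (auto simp: next_match_def find_None_iff)

text \<open>Used twice: for well-formedness of the machine, and for keeping a run inside the part of
  \<open>act\<close> that was turned into transitions.\<close>

lemma act_closed:
  assumes "act q r h c = Some (q', as, ah, ac)"
    and "q \<in> dstates" "set r \<subseteq> symbols" "length r = ntapes M" "h \<in> symbols" "c \<in> symbols"
  shows "q' \<in> dstates \<and> length as = ntapes M \<and> fst ` set as \<subseteq> symbols \<and>
    fst ah \<in> symbols \<and> fst ac \<in> symbols"
proof -
  have base: "Blank \<in> symbols" "Bit b \<in> symbols" "Sep \<in> symbols" "start M \<in> states M"
    "1 \<le> ntapes M" for b
    using wf by (cases b; auto simp: symbols_def wf_tm_def)+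
  have sub: "alphabet M \<subseteq> symbols" by (auto simp: symbols_def)
  from base(5) assms(4) obtain a r' where r: "r = a # r'" by (cases r) auto
  have idle: "length (idle xs) = length xs" "(x, m) \<in> set (idle xs) \<longleftrightarrow> x \<in> set xs \<and> m = Stay"
    for xs x m by (auto simp: idle_def)
  have tr: "target (trs ! j) \<in> states M" "length (reads (trs ! j)) = ntapes M"
    "x \<in> set (reads (trs ! j)) \<Longrightarrow> x \<in> symbols" "length (writes (trs ! j)) = ntapes M"
    "x \<in> set (writes (trs ! j)) \<Longrightarrow> x \<in> symbols" "length (moves (trs ! j)) = ntapes M"
    "Work j \<in> symbols" if "j < length trs" for j x
    using trs_nth[OF that] sub that by (auto simp: wf_transition_def symbols_def)
  have "?thesis" if "\<nexists>j. q = Undo j" "\<nexists>j. q = Down j"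
    using assms that base(1-4)
    by (cases q) (auto simp: r dstates_def idle tr dest!: set_zip_leftD split: if_splits symbol.splits)
  moreover have ?thesis if "q = Down j" for j
    using assms that
    by (auto simp: dstates_def idle split: option.splits dest!: next_match_SomeD(2))
  moreover have ?thesis if "q = Undo j" for j
    using assms that
    by (auto simp: dstates_def idle tr split: option.splits dest!: next_match_SomeD(2))
  ultimately show ?thesis by blast
qed

lemma wf_machine: "wf_tm machine"
proof -
  have ne: "r \<noteq> []" if "length r = ntapes M" for r :: "'b list"
    using that wf by (auto simp: wf_tm_def)
  have "wf_transition machine t" if "t \<in> transitions machine" for t
  proof -
    from that obtain q r h c q' as ah ac where t:
      "t = transition_of q r h c (q', as, ah, ac)"
      and *: "q \<in> dstates" "set r \<subseteq> symbols" "length r = ntapes M" "h \<in> symbols" "c \<in> symbols"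
        "act q r h c = Some (q', as, ah, ac)"
      unfolding transitions_machine by (metis prod_cases4)
    note cl = act_closed[OF *(6,1-5)]
    have "r \<noteq> []" "as \<noteq> []" using ne *(3) cl by auto
    then show ?thesis using t * cl
      by (auto simp: wf_transition_def machine_def transition_of_def length_mix set_mix)
  qed
  moreover have "finite dstates" "finite symbols"
    using wf by (auto simp: dstates_def symbols_def wf_tm_def)
  ultimately show ?thesis
    using wf by (auto simp: wf_tm_def machine_def dstates_def symbols_def)
qed

text \<open>\<open>act\<close> is a function of state and scanned symbols, and these are recovered
  from \<open>source\<close> and \<open>reads\<close> because \<open>to_nat\<close> is injective and
  so is \<open>mix\<close> on nonempty lists.\<close>

lemma deterministic_machine: "deterministic machine"
proof -
  have ne: "r \<noteq> []" if "length r = ntapes M" for r :: "'b list"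
    using that wf by (auto simp: wf_tm_def)
  show ?thesis
    unfolding deterministic_def
  proof (intro ballI impI)
    fix t t'
    assume "t \<in> transitions machine" "t' \<in> transitions machine"
      and eq: "source t = source t' \<and> reads t = reads t'"
    then obtain q r h c a q' r' h' c' a' where
      t: "t = transition_of q r h c a" "length r = ntapes M" "act q r h c = Some a"
      and t': "t' = transition_of q' r' h' c' a'" "length r' = ntapes M" "act q' r' h' c' = Some a'"
      unfolding transitions_machine by blast
    have "q = q'" "r = r'" "h = h'" "c = c'"
      using eq t(1,2) t'(1,2) by (auto simp: transition_of_def mix_inject ne split: prod.splits)
    then show "t = t'" using t t' by simp
  qed
qed

text \<open>All cells, not only the scanned ones, have to hold letters of \<open>symbols\<close>:
  heads may reach any of them later, and \<open>machine\<close> has transitions for these letters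
  only.\<close>

lemma run_machine:
  assumes "(step ^^ m) (q, tps, ht, ct) (q', tps', ht', ct')"
    and "q \<in> dstates" "length tps = ntapes M"
    and "\<And>tp. tp \<in> set tps \<union> {ht, ct} \<Longrightarrow> range (fst tp) \<subseteq> symbols"
  shows "\<exists>ts. length ts = m \<and> run machine (to_nat q, mix tps ht ct) ts (to_nat q', mix tps' ht' ct')"
  using assms
proof (induction m arbitrary: q tps ht ct)
  case 0
  then show ?case by (auto simp: run_Nil_iff)
next
  case (Suc m)
  from relpowp_Suc_D2[OF Suc.prems(1)] obtain q1 tps1 ht1 ct1 where
    s1: "step (q, tps, ht, ct) (q1, tps1, ht1, ct1)"
    and sm: "(step ^^ m) (q1, tps1, ht1, ct1) (q', tps', ht', ct')"
    by (metis prod_cases4)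
  from s1 obtain as ah ac where
    a: "act q (map scanned tps) (scanned ht) (scanned ct) = Some (q1, as, ah, ac)"
    and eq: "tps1 = map2 update_tape tps as" "ht1 = update_tape ht ah" "ct1 = update_tape ct ac"
    by (auto simp: step_def)
  have sc: "scanned tp \<in> symbols" if "tp \<in> set tps \<union> {ht, ct}" for tp
    using Suc.prems(4)[OF that] by (cases tp) auto
  have cl: "q1 \<in> dstates" "length as = ntapes M" "fst ` set as \<subseteq> symbols" "fst ah \<in> symbols"
    "fst ac \<in> symbols"
    using act_closed[OF a Suc.prems(2)] sc[simplified] Suc.prems(3) by (simp_all add: image_subset_iff)
  have ne: "tps \<noteq> []" "as \<noteq> []" using cl(2) Suc.prems(3) wf by (auto simp: wf_tm_def)
  let ?t = "transition_of q (map scanned tps) (scanned ht) (scanned ct) (q1, as, ah, ac)"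
  have t: "?t \<in> transitions machine"
  proof -
    have "set (map scanned tps) \<subseteq> symbols" "scanned ht \<in> symbols" "scanned ct \<in> symbols"
      using sc by auto
    with Suc.prems(2,3) a show ?thesis
      unfolding transitions_machine by (metis length_map)
  qed
  have en: "enabled ?t (to_nat q, mix tps ht ct)"
    using ne by (simp add: enabled_def transition_of_def map_mix)
  have fi: "fire ?t (to_nat q, mix tps ht ct) = (to_nat q1, mix tps1 ht1 ct1)"
    using ne by (simp add: fire_def transition_of_def eq zip_mix map_mix zip_map_fst_snd)
  have upd: "range (fst (update_tape tp a)) \<subseteq> symbols"
    if "range (fst tp) \<subseteq> symbols" "fst a \<in> symbols" for tp a
    using that by (cases tp; cases a) auto
  have in_symbols: "range (fst tp) \<subseteq> symbols" if tp: "tp \<in> set tps1 \<union> {ht1, ct1}" for tp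
  proof (cases "tp \<in> set tps1")
    case True
    then obtain x a where "(x, a) \<in> set (zip tps as)" "tp = update_tape x a"
      by (auto simp: eq)
    moreover from this have "x \<in> set tps" "a \<in> set as"
      by (auto dest: set_zip_leftD set_zip_rightD)
    ultimately show ?thesis using upd Suc.prems(4) cl(3) by blast
  next
    case False
    then consider "tp = update_tape ht ah" | "tp = update_tape ct ac" using tp eq by auto
    then show ?thesis using upd[OF Suc.prems(4)] cl(4,5) by cases simp_all
  qed
  have "length tps1 = ntapes M" using eq cl(2) Suc.prems(3) by simp
  from Suc.IH[OF sm cl(1) this in_symbols] obtain ts where
    "length ts = m" "run machine (to_nat q1, mix tps1 ht1 ct1) ts (to_nat q', mix tps' ht' ct')"
    by blast
  then show ?case using t en fi by (intro exI[of _ "?t # ts"]) (simp add: run_Cons_iff)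
qed

lemma halted_machine:
  assumes "\<And>r h c. act q r h c = None"
  shows "halted machine (to_nat q, tps)"
  using assms
  by (auto simp: halted_def enabled_def transitions_machine transition_of_def split: prod.splits)

subsection \<open>Correctness of the search\<close>

abbreviation counter :: "bool list \<Rightarrow> tape" where
  "counter bs \<equiv> (cells (map Bit bs), int (length bs))"

text \<open>\<open>post\<close> absorbs the ones already written, hence its generalization. The end
  position is an integer difference because an empty \<open>pre\<close> leads to cell -1, where
  underflow is detected.\<close>

lemma reach_DecL:
  "reach m
     (DecL i, tps, ht, (cells (map Bit (pre @ replicate m False @ post)), int (length pre + m) - 1))
     (DecL i, tps, ht, (cells (map Bit (pre @ replicate m True @ post)), int (length pre) - 1))"
proof (induction m arbitrary: post)
  case 0
  show ?case by (simp add: reach_refl)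
next
  case (Suc m)
  let ?w = "map Bit (pre @ replicate m False)"
  have len: "int (length pre + Suc m) - 1 = int (length ?w)" by simp
  have 1: "map Bit (pre @ replicate (Suc m) False @ post) = ?w @ Bit False # map Bit post"
    by (simp add: replicate_app_Cons_same)
  have 2: "map Bit (pre @ replicate m False @ True # post) = ?w @ Bit True # map Bit post"
    by simp
  have 3: "pre @ replicate (Suc m) True @ post = pre @ replicate m True @ True # post"
    by (simp add: replicate_app_Cons_same)
  have "step (DecL i, tps, ht, (cells (?w @ Bit False # map Bit post), int (length ?w)))
    (DecL i, tps, ht, (cells (?w @ Bit True # map Bit post), int (length ?w) - 1))"
    by (rule stepI[where as = "idle (map scanned tps)" and ah = "(scanned ht, Stay)"
          and ac = "(Bit True, Move_Left)"])
       (simp_all add: cells_middle cells_middle_update map2_update_idle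
         del: map_append length_map length_append)
  from reach_step[OF this] Suc.IH[of "True # post"] show ?case
    unfolding len 1 2 3 by simp
qed

lemma reach_DecR:
  "reach (length post) (DecR i, tps, ht, (cells (map Bit (pre @ post)), int (length pre)))
     (DecR i, tps, ht, counter (pre @ post))"
proof (induction post arbitrary: pre)
  case Nil
  show ?case by (simp add: reach_refl)
next
  case (Cons b post)
  have "cells (map Bit (pre @ b # post)) (int (length pre)) = Bit b"
    using cells_middle[of "map Bit pre"] by simp
  then have "step (DecR i, tps, ht, (cells (map Bit (pre @ b # post)), int (length pre)))
    (DecR i, tps, ht, (cells (map Bit ((pre @ [b]) @ post)), int (length (pre @ [b]))))"
    by (intro stepI[where as = "idle (map scanned tps)" and ah = "(scanned ht, Stay)"
          and ac = "(Bit b, Move_Right)"])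
       (auto simp: map2_update_idle)
  from reach_step[OF this Cons.IH] show ?case by simp
qed

lemma reach_decrement:
  assumes "bits_val bs > 0"
  shows "\<exists>bs'. length bs' = length bs \<and> Suc (bits_val bs') = bits_val bs \<and>
    reach (2 * length bs + 2) (DecL i, tps, ht, (cells (map Bit bs), int (length bs) - 1))
      (Fire i, tps, ht, counter bs')"
proof -
  obtain pre m where bs: "bs = pre @ True # replicate m False"
    and val: "Suc (bits_val (pre @ False # replicate m True)) = bits_val bs"
    using bits_val_pred[OF assms] .
  let ?bs' = "pre @ False # replicate m True"
  \<comment> \<open>With \<open>pre @ [True]\<close> as the untouched prefix, the head stops on that
    \<open>True\<close>.\<close>
  have "reach m (DecL i, tps, ht, (cells (map Bit bs), int (length bs) - 1))
    (DecL i, tps, ht, (cells (map Bit (pre @ True # replicate m True)), int (length pre)))"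
    using reach_DecL[of m i tps ht "pre @ [True]" "[]"] by (simp add: bs)
  moreover have "step (DecL i, tps, ht, (cells (map Bit (pre @ True # replicate m True)),
      int (length pre)))
    (DecR i, tps, ht, (cells (map Bit ((pre @ [False]) @ replicate m True)),
      int (length (pre @ [False]))))"
    using cells_middle[of "map Bit pre"] cells_middle_update[of "map Bit pre"]
    by (intro stepI[where as = "idle (map scanned tps)" and ah = "(scanned ht, Stay)"
          and ac = "(Bit False, Move_Right)"])
       (simp_all add: map2_update_idle)
  moreover have "reach m (DecR i, tps, ht, (cells (map Bit ((pre @ [False]) @ replicate m True)),
      int (length (pre @ [False]))))
    (DecR i, tps, ht, counter ?bs')"
    using reach_DecR[of "replicate m True" i tps ht "pre @ [False]"] by simp
  moreover have "step (DecR i, tps, ht, counter ?bs') (Fire i, tps, ht, counter ?bs')"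
    using cells_end[of "map Bit ?bs'"]
    by (intro stepI[where as = "idle (map scanned tps)" and ah = "(scanned ht, Stay)"
          and ac = "(Blank, Stay)"])
       (auto simp: map2_update_idle fun_upd_idem)
  \<comment> \<open>\<open>m\<close> steps to the left, one to clear the \<open>True\<close>,
    \<open>m\<close> back, and one on the blank behind the last bit.\<close>
  ultimately have "reach (m + Suc (m + Suc 0))
      (DecL i, tps, ht, (cells (map Bit bs), int (length bs) - 1))
      (Fire i, tps, ht, counter ?bs')"
    by (meson reach_trans reach_step reach_refl)
  then have "reach (2 * length bs + 2) (DecL i, tps, ht, (cells (map Bit bs), int (length bs) - 1))
      (Fire i, tps, ht, counter ?bs')"
    by (rule reach_mono) (simp add: bs)
  then show ?thesis using val bs by (intro exI[of _ ?bs']) simp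
qed

text \<open>Without any \<open>True\<close> to stop at, the head flips every bit and runs onto the
  blank cell -1.\<close>

lemma reach_underflow:
  assumes "bits_val bs = 0"
  shows "\<exists>c. reach (2 * length bs + 2) (DecL i, tps, ht, (cells (map Bit bs), int (length bs) - 1))
      (Reject, c)"
proof -
  let ?m = "length bs"
  have "bs = replicate ?m False" by (rule bits_val_eq_0[OF assms])
  then have "reach ?m (DecL i, tps, ht, (cells (map Bit bs), int ?m - 1))
    (DecL i, tps, ht, (cells (map Bit (replicate ?m True)), - 1))"
    using reach_DecL[of ?m i tps ht "[]" "[]"] by simp
  moreover have "step (DecL i, tps, ht, (cells (map Bit (replicate ?m True)), - 1))
    (Reject, tps, ht, (cells (map Bit (replicate ?m True)), - 1))"
    by (intro stepI[where as = "idle (map scanned tps)" and ah = "(scanned ht, Stay)"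
          and ac = "(Blank, Stay)"])
       (auto simp: map2_update_idle fun_upd_idem cells_negative)
  ultimately have "reach (?m + Suc 0) (DecL i, tps, ht, (cells (map Bit bs), int ?m - 1))
    (Reject, tps, ht, (cells (map Bit (replicate ?m True)), - 1))"
    by (meson reach_trans reach_step reach_refl)
  then have "reach (2 * ?m + 2) (DecL i, tps, ht, (cells (map Bit bs), int ?m - 1))
    (Reject, tps, ht, (cells (map Bit (replicate ?m True)), - 1))"
    by (rule reach_mono) simp
  then show ?thesis by blast
qed

text \<open>Reversing the moves while rewriting what is scanned brings each head back to the cell it
  changed; since \<open>t\<close> was enabled, \<open>reads t\<close> holds the old contents of
  these cells.\<close>

lemma undo_fire:
  assumes "enabled t (q, tps)" "wf_transition M t" "length tps = ntapes M"
    and "tps' = snd (fire t (q, tps))"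
  shows "map2 update_tape (map2 update_tape tps' (zip (map scanned tps') (map inverse_move (moves t))))
    (idle (reads t)) = tps"
proof (rule nth_equalityI)
  show len: "length (map2 update_tape (map2 update_tape tps' (zip (map scanned tps')
    (map inverse_move (moves t)))) (idle (reads t))) = length tps"
    using assms by (simp add: fire_def wf_transition_def idle_def)
  fix i
  assume i: "i < length (map2 update_tape (map2 update_tape tps' (zip (map scanned tps')
    (map inverse_move (moves t)))) (idle (reads t)))"
  obtain u p where up: "tps ! i = (u, p)" by (cases "tps ! i")
  have "shift (inverse_move m) = - shift m" for m by (cases m) auto
  then show "map2 update_tape (map2 update_tape tps' (zip (map scanned tps')
    (map inverse_move (moves t)))) (idle (reads t)) ! i = tps ! i"
    using assms(1-3) i up unfolding len assms(4)
    by (simp add: fire_def wf_transition_def idle_def enabled_def)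
qed

text \<open>
  Processing \<open>L\<close> leaves, with time \<open>K\<close> charged to each, uses up \<open>L - 1\<close> units of the counter;
  the unit that separates two sibling subtrees is paid between them.
\<close>

definition traverses :: "nat \<Rightarrow> nat \<Rightarrow> dstate \<Rightarrow> tape list \<Rightarrow> tape \<Rightarrow> bool list \<Rightarrow> bool" where
  "traverses L K q tps ht bs \<longleftrightarrow>
    (if L \<le> bits_val bs + 1
     then \<exists>bs'. length bs' = length bs \<and> bits_val bs' + L = bits_val bs + 1 \<and>
       reach (L * K) (q, tps, ht, counter bs) (Back, tps, ht, counter bs')
     else \<exists>c. reach ((bits_val bs + 1) * K) (q, tps, ht, counter bs) (Reject, c))"

section \<open>Amortized accounting of leaves and time\<close>

lemma traverses_BackI:
  assumes "length bs' = length bs" "bits_val bs' + L = bits_val bs + 1"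
    and "reach (L * K) (q, tps, ht, counter bs) (Back, tps, ht, counter bs')"
  shows "traverses L K q tps ht bs"
proof -
  have *: "L \<le> bits_val bs + 1" using assms(2) by simp
  from assms show ?thesis unfolding traverses_def if_P[OF *] by blast
qed

lemma traverses_RejectI:
  assumes "bits_val bs + 1 < L"
    and "reach ((bits_val bs + 1) * K) (q, tps, ht, counter bs) (Reject, c)"
  shows "traverses L K q tps ht bs"
proof -
  from assms(1) have *: "\<not> L \<le> bits_val bs + 1" by simp
  from assms(2) show ?thesis unfolding traverses_def if_not_P[OF *] by blast
qed

lemma traverses_cases:
  assumes "traverses L K q tps ht bs"
  obtains bs' where "length bs' = length bs" "bits_val bs' + L = bits_val bs + 1"
      "reach (L * K) (q, tps, ht, counter bs) (Back, tps, ht, counter bs')"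
    | c where "bits_val bs + 1 < L"
      "reach ((bits_val bs + 1) * K) (q, tps, ht, counter bs) (Reject, c)"
proof (cases "L \<le> bits_val bs + 1")
  case True
  from assms that(1) show thesis unfolding traverses_def if_P[OF True] by blast
next
  case False
  then have "bits_val bs + 1 < L" by simp
  with assms that(2) show thesis unfolding traverses_def if_not_P[OF False] by blast
qed

text \<open>The extra step is paid by raising the price of every leaf by one; at least one leaf is
  charged in either outcome.\<close>

lemma traverses_step:
  assumes "step (q, tps, ht, counter bs) (q', tps, ht, counter bs)"
    and "traverses L K q' tps ht bs" "0 < L"
  shows "traverses L (K + 1) q tps ht bs"
proof -
  have *: "reach (n * (K + 1)) (q, tps, ht, counter bs) c"
    if "reach (n * K) (q', tps, ht, counter bs) c" "0 < n" for n c
    by (rule reach_mono[OF reach_step[OF assms(1) that(1)]]) (use that(2) in simp)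
  from assms(2) show ?thesis
  proof (cases rule: traverses_cases)
    case (1 bs')
    then show ?thesis using *[OF _ assms(3)] by (intro traverses_BackI)
  next
    case (2 c)
    show ?thesis using *[OF 2(2)] by (intro traverses_RejectI[OF 2(1)]) simp
  qed
qed

text \<open>Induction on the number of list positions from \<open>j\<close> on. The assumption on
  children leaves the history and the counter value open, since both change between siblings; only
  the width \<open>w\<close> is fixed, because \<open>K\<close> may depend on it.\<close>

lemma traverses_siblings:
  assumes child: "\<And>j bs u p. j < length trs \<Longrightarrow> matches q (map scanned tps) j \<Longrightarrow> length bs = w \<Longrightarrow>
      \<forall>i\<ge>p. u i = Blank \<Longrightarrow> traverses (leaves M (fire (trs ! j) (q, tps))) K
        (Down (target (trs ! j))) (snd (fire (trs ! j) (q, tps))) (u, p) bs"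
    and pos: "\<And>j. j < length trs \<Longrightarrow> matches q (map scanned tps) j \<Longrightarrow>
      0 < leaves M (fire (trs ! j) (q, tps))"
    and tps: "length tps = ntapes M" and blank: "\<forall>i\<ge>p. u i = Blank"
    and "j < length trs" "matches q (map scanned tps) j" "length bs = w"
  shows "traverses (\<Sum>l | j \<le> l \<and> l < length trs \<and> matches q (map scanned tps) l.
      leaves M (fire (trs ! l) (q, tps))) (K + 2 * w + 6) (Fire j) tps (u, p) bs"
  using assms(5-7)
proof (induction "length trs - j" arbitrary: j bs rule: less_induct)
  case less
  let ?S = "\<lambda>j. {l. j \<le> l \<and> l < length trs \<and> matches q (map scanned tps) l}"
  let ?L = "\<lambda>l. leaves M (fire (trs ! l) (q, tps))"
  let ?t = "trs ! j" and ?K = "K + 2 * w + 6" and ?v = "bits_val bs"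
  let ?s = "(Fire j, tps, (u, p), counter bs)"
  define tps1 where "tps1 = snd (fire ?t (q, tps))"
  define tps2 where "tps2 = map2 update_tape tps1 (zip (map scanned tps1) (map inverse_move (moves ?t)))"
  have en: "enabled ?t (q, tps)" using less.prems(2) by (simp add: enabled_def matches_def)
  note wft = trs_nth(2)[OF less.prems(1)]
  have fin: "finite (?S i)" for i by simp
  have pos_j: "0 < ?L j" using pos less.prems by blast
  \<comment> \<open>Overhead of one child: \<open>Fire\<close>, \<open>Back\<close>,
    \<open>Pop\<close> and \<open>Undo\<close> take one step each, and a decrement takes at most
    \<open>2 * w + 2\<close>. A single leaf of the child covers it all.\<close>
  have budget: "?L j * K + 2 * w + 6 \<le> ?L j * ?K"
  proof -
    have "?L j * ?K = ?L j * K + ?L j * (2 * w + 6)"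
      unfolding distrib_left[symmetric] by (simp add: add.assoc)
    moreover have "2 * w + 6 \<le> ?L j * (2 * w + 6)" using pos_j by (cases "?L j") auto
    ultimately show ?thesis by linarith
  qed
  have s1: "step ?s (Down (target ?t), tps1, (u(p := Work j), p + 1), counter bs)"
    by (rule stepI) (auto simp: tps1_def fire_def)
  have "\<forall>i\<ge>p + 1. (u(p := Work j)) i = Blank" using blank by auto
  from child[OF less.prems this]
  have ch: "traverses (?L j) K (Down (target ?t)) tps1 (u(p := Work j), p + 1) bs"
    by (simp only: tps1_def)
  from ch show ?case
  proof (cases rule: traverses_cases)
    case (2 c)
    from reach_step[OF s1 2(2)] have "reach ((?v + 1) * ?K) ?s (Reject, c)"
      by (rule reach_mono) (simp add: algebra_simps)
    moreover have "?L j \<le> sum ?L (?S j)" using less.prems fin by (intro member_le_sum) auto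
    ultimately show ?thesis using 2(1) by (intro traverses_RejectI) auto
  next
    case (1 bs1)
    then have bs1: "length bs1 = w" "bits_val bs1 + ?L j = ?v + 1" using less.prems(3) by simp_all
    note r1 = 1(3)
    have s2: "step (Back, tps1, (u(p := Work j), p + 1), counter bs1)
      (Pop, tps1, (u(p := Work j), p), counter bs1)"
      by (rule stepI[OF act.simps(7)]) (auto simp: map2_update_idle fun_eq_iff)
    \<comment> \<open>Erasing the stack symbol gives back \<open>u\<close> itself, because
      \<open>u p\<close> was \<open>Blank\<close> before the push.\<close>
    have s3: "step (Pop, tps1, (u(p := Work j), p), counter bs1) (Undo j, tps2, (u, p), counter bs1)"
      by (rule stepI[where as = "zip (map scanned tps1) (map inverse_move (moves ?t))"
            and ah = "(Blank, Stay)" and ac = "(scanned (counter bs1), Stay)"])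
         (use less.prems(1) blank in \<open>auto simp: tps2_def fun_upd_idem\<close>)
    have tps_eq: "map2 update_tape tps2 (idle (reads ?t)) = tps"
      unfolding tps2_def by (rule undo_fire[OF en wft tps tps1_def])
    \<comment> \<open>\<open>Undo j\<close> remembers only \<open>j\<close>; the parent's state and
      scanned symbols are recovered from the transition, so the search for the next sibling looks at
      the right node.\<close>
    have key: "source ?t = q" "reads ?t = map scanned tps"
      using less.prems(2) by (auto simp: matches_def)
    have pre: "reach (Suc (?L j * K + 3 + n)) ?s c"
      if "reach n c' c" "step (Undo j, tps2, (u, p), counter bs1) c'" for n c c'
    proof -
      have "reach (Suc (Suc (Suc n))) (Back, tps1, (u(p := Work j), p + 1), counter bs1) c"
        using that s2 s3 reach_step by blast
      from reach_step[OF s1 reach_trans[OF r1 this]] show ?thesis by (simp add: eval_nat_numeral)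
    qed
    show ?thesis
    proof (cases "next_match (Suc j) q (map scanned tps)")
      case None
      have "?S j = {j}"
        using less.prems next_match_NoneD[OF None] by (auto simp: Suc_le_eq intro: le_neq_implies_less)
      then have S: "sum ?L (?S j) = ?L j" by simp
      have "step (Undo j, tps2, (u, p), counter bs1) (Back, tps, (u, p), counter bs1)"
        by (rule stepI[where as = "idle (reads ?t)" and ah = "(u p, Stay)"
              and ac = "(scanned (counter bs1), Stay)"])
           (simp_all add: tps_eq[unfolded key(2)] key None)
      from pre[OF reach_refl[of 0] this] have "reach (?L j * ?K) ?s (Back, tps, (u, p), counter bs1)"
        by (rule reach_mono) (use budget in linarith)
      then show ?thesis unfolding S using bs1 less.prems(3)
        by (intro traverses_BackI[where bs' = bs1]) simp_all
    next
      case (Some i)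
      note i = next_match_SomeD[OF this]
      have "?S j = insert j (?S i)"
      proof (intro equalityI subsetI)
        fix l assume l: "l \<in> ?S j"
        show "l \<in> insert j (?S i)"
        proof (cases "l = j")
          case False
          then have "i \<le> l" using l i(4)[of l] by (auto simp: not_less[symmetric])
          then show ?thesis using l by simp
        qed simp
      qed (use less.prems i(1) in auto)
      then have S: "sum ?L (?S j) = ?L j + sum ?L (?S i)" using i(1) fin by simp
      have "?L i \<le> sum ?L (?S i)" using i fin by (intro member_le_sum) auto
      then have Si: "0 < sum ?L (?S i)" using pos[OF i(2,3)] by simp
      have s4: "step (Undo j, tps2, (u, p), counter bs1)
          (DecL i, tps, (u, p), (cells (map Bit bs1), int (length bs1) - 1))"
        by (rule stepI[where as = "idle (reads ?t)" and ah = "(u p, Stay)"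
              and ac = "(scanned (counter bs1), Move_Left)"])
           (simp_all add: tps_eq[unfolded key(2)] key Some)
      show ?thesis
      proof (cases "bits_val bs1 = 0")
        case True
        from reach_underflow[OF this] obtain c where
          "reach (2 * w + 2) (DecL i, tps, (u, p), (cells (map Bit bs1), int (length bs1) - 1))
            (Reject, c)"
          using bs1(1) by metis
        from pre[OF this s4] have "reach (?L j * ?K) ?s (Reject, c)"
          by (rule reach_mono) (use budget in linarith)
        \<comment> \<open>Child \<open>j\<close> alone has used up the budget, and the sibling
          \<open>i\<close> adds at least one more leaf.\<close>
        moreover have "?L j = ?v + 1" using bs1 True by simp
        ultimately show ?thesis unfolding S using Si by (intro traverses_RejectI[where c = c]) simp_all
      next
        case False
        then obtain bs2 where bs2: "length bs2 = w" "Suc (bits_val bs2) = bits_val bs1"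
          and r2: "reach (2 * w + 2) (DecL i, tps, (u, p), (cells (map Bit bs1), int (length bs1) - 1))
            (Fire i, tps, (u, p), counter bs2)"
          using reach_decrement[of bs1 i tps "(u, p)"] bs1(1) by auto
        have "length trs - i < length trs - j" using i(1,2) by simp
        from less.hyps[OF this i(2,3) bs2(1)]
        have tr: "traverses (sum ?L (?S i)) ?K (Fire i) tps (u, p) bs2" .
        have r3: "reach ((?L j + n) * ?K) ?s c"
          if "reach (n * ?K) (Fire i, tps, (u, p), counter bs2) c" for n c
          using pre[OF reach_trans[OF r2 that] s4]
        proof (rule reach_mono)
          have "(?L j + n) * ?K = ?L j * ?K + n * ?K" by (rule distrib_right)
          then show "Suc (?L j * K + 3 + (2 * w + 2 + n * ?K)) \<le> (?L j + n) * ?K"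
            using budget by linarith
        qed
        \<comment> \<open>The \<open>+ 1\<close> in the balance of the child cancels against the
          unit taken by the decrement, so the balances of child and remaining siblings simply add
          up.\<close>
        have v: "?v = bits_val bs2 + ?L j" using bs1 bs2 by simp
        from tr show ?thesis
        proof (cases rule: traverses_cases)
          case (1 bs3)
          then show ?thesis unfolding S
            using r3[OF 1(3)] bs2(1) less.prems(3) v by (intro traverses_BackI[where bs' = bs3]) simp_all
        next
          case (2 c)
          from r3[OF 2(2)] have "reach ((?v + 1) * ?K) ?s (Reject, c)" by (simp add: v algebra_simps)
          then show ?thesis unfolding S using 2(1) v by (intro traverses_RejectI) simp_all
        qed
      qed
    qed
  qed
qed

text \<open>Each level costs \<open>2 * length bs + 6\<close> for the siblings and 1 for the step
  out of \<open>Down\<close>, which gives the factor \<open>2 * length bs + 7\<close>; the final 1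
  is the step that recognizes a leaf.\<close>

lemma traverses_Down:
  assumes "depth_le M (q, tps) d" "length tps = ntapes M" "\<forall>i\<ge>p. u i = Blank"
  shows "traverses (leaves M (q, tps)) ((2 * length bs + 7) * d + 1) (Down q) tps (u, p) bs"
  using assms
proof (induction d arbitrary: q tps u p bs rule: less_induct)
  case (less d)
  let ?P = "matches q (map scanned tps)" and ?L = "\<lambda>l. leaves M (fire (trs ! l) (q, tps))"
  have en: "enabled (trs ! l) (q, tps) \<longleftrightarrow> ?P l" for l by (auto simp: enabled_def matches_def)
  show ?case
  proof (cases "next_match 0 q (map scanned tps)")
    case None
    have "halted M (q, tps)"
      using next_match_NoneD[OF None] en unfolding halted_def set_trs[symmetric]
      by (metis in_set_conv_nth le0)
    then have L: "leaves M (q, tps) = 1" by (rule leaves_halted)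
    have "step (Down q, tps, (u, p), counter bs) (Back, tps, (u, p), counter bs)"
      by (rule stepI[where as = "idle (map scanned tps)" and ah = "(u p, Stay)"
            and ac = "(scanned (counter bs), Stay)"])
         (simp_all add: None map2_update_idle)
    from reach_step[OF this reach_refl[of "(2 * length bs + 7) * d"]] show ?thesis
      unfolding L by (intro traverses_BackI) simp_all
  next
    case (Some j)
    note j = next_match_SomeD[OF this]
    have nh: "\<not> halted M (q, tps)" using trs_nth(1)[OF j(2)] en j(3) by (auto simp: halted_def)
    from depth_le_fire[OF less.prems(1) trs_nth(1)[OF j(2)]] j(3) en
    obtain d' where d: "d = Suc d'" by blast
    have dep: "depth_le M (fire (trs ! l) (q, tps)) d'" if "l < length trs" "?P l" for l
      using depth_le_fire[OF less.prems(1) trs_nth(1)[OF that(1)]] that(2) en d by blast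
    \<comment> \<open>Distinctness of \<open>trs\<close> turns the sum over enabled transitions into
      one over list positions; starting at \<open>j\<close> loses nothing, as \<open>j\<close> is
      the first match.\<close>
    have "bij_betw ((!) trs) {l. j \<le> l \<and> l < length trs \<and> ?P l} {t \<in> transitions M. enabled t (q, tps)}"
    proof (rule bij_betw_imageI)
      show "inj_on ((!) trs) {l. j \<le> l \<and> l < length trs \<and> ?P l}"
        using distinct_trs by (auto intro!: inj_onI simp: nth_eq_iff_index_eq)
      show "(!) trs ` {l. j \<le> l \<and> l < length trs \<and> ?P l} = {t \<in> transitions M. enabled t (q, tps)}"
      proof (intro equalityI subsetI)
        fix t assume "t \<in> (!) trs ` {l. j \<le> l \<and> l < length trs \<and> ?P l}"
        then show "t \<in> {t \<in> transitions M. enabled t (q, tps)}" using trs_nth(1) en by auto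
      next
        fix t assume "t \<in> {t \<in> transitions M. enabled t (q, tps)}"
        then obtain l where l: "l < length trs" "t = trs ! l" "?P l"
          using en by (auto simp: set_trs[symmetric] in_set_conv_nth)
        moreover have "j \<le> l" using j(4)[of l] l(3) by (meson le0 not_le)
        ultimately show "t \<in> (!) trs ` {l. j \<le> l \<and> l < length trs \<and> ?P l}" by blast
      qed
    qed
    then have L: "leaves M (q, tps) = (\<Sum>l | j \<le> l \<and> l < length trs \<and> ?P l. ?L l)"
      unfolding leaves_not_halted[OF wf less.prems(1) nh] by (rule sum.reindex_bij_betw[symmetric])
    have "traverses (\<Sum>l | j \<le> l \<and> l < length trs \<and> ?P l. ?L l)
      (((2 * length bs + 7) * d' + 1) + 2 * length bs + 6) (Fire j) tps (u, p) bs"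
    proof (rule traverses_siblings[OF _ _ less.prems(2,3) j(2,3) refl])
      fix l and bs' :: "bool list" and u' :: "int \<Rightarrow> symbol" and p' :: int
      assume l: "l < length trs" "?P l" "length bs' = length bs" and blank: "\<forall>i\<ge>p'. u' i = Blank"
      have c: "fire (trs ! l) (q, tps) = (target (trs ! l), snd (fire (trs ! l) (q, tps)))"
        by (simp add: fire_def)
      have "length (snd (fire (trs ! l) (q, tps))) = ntapes M"
        using less.prems(2) trs_nth(2)[OF l(1)] by (simp add: fire_def wf_transition_def)
      moreover have "depth_le M (target (trs ! l), snd (fire (trs ! l) (q, tps))) d'"
        using dep[OF l(1,2)] c by simp
      ultimately have "traverses (leaves M (target (trs ! l), snd (fire (trs ! l) (q, tps))))
        ((2 * length bs' + 7) * d' + 1) (Down (target (trs ! l)))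
        (snd (fire (trs ! l) (q, tps))) (u', p') bs'"
        using less.IH[of d'] d blank by blast
      then show "traverses (?L l) ((2 * length bs + 7) * d' + 1) (Down (target (trs ! l)))
        (snd (fire (trs ! l) (q, tps))) (u', p') bs'"
        unfolding l(3) c[symmetric] .
    next
      fix l assume "l < length trs" "?P l"
      then show "0 < ?L l" using leaves_pos[OF wf dep] by blast
    qed
    moreover have "step (Down q, tps, (u, p), counter bs) (Fire j, tps, (u, p), counter bs)"
      by (rule stepI[where as = "idle (map scanned tps)" and ah = "(u p, Stay)"
            and ac = "(scanned (counter bs), Stay)"])
         (simp_all add: Some map2_update_idle)
    ultimately have "traverses (leaves M (q, tps))
      (((2 * length bs + 7) * d' + 1) + 2 * length bs + 6 + 1) (Down q) tps (u, p) bs"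
      unfolding L[symmetric] by (intro traverses_step leaves_pos[OF wf less.prems(1)])
    then show ?thesis by (simp add: d algebra_simps)
  qed
qed

subsection \<open>Preparing the tapes\<close>

lemma reach_Scan:
  "reach (length ys)
     (Scan, (cells (map Bit (xs @ ys) @ Sep # zs), int (length xs)) # tps, (u, int (length xs)), ct)
     (Scan, (cells (map Bit (xs @ ys) @ Sep # zs), int (length (xs @ ys))) # tps,
       (u, int (length (xs @ ys))), ct)"
proof (induction ys arbitrary: xs)
  case Nil
  show ?case by (simp add: reach_refl)
next
  case (Cons y ys)
  have "cells (map Bit (xs @ y # ys) @ Sep # zs) (int (length xs)) = Bit y"
    using cells_middle[of "map Bit xs"] by simp
  then have "step
    (Scan, (cells (map Bit (xs @ y # ys) @ Sep # zs), int (length xs)) # tps, (u, int (length xs)), ct)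
    (Scan, (cells (map Bit ((xs @ [y]) @ ys) @ Sep # zs), int (length (xs @ [y]))) # tps,
      (u, int (length (xs @ [y]))), ct)"
    by (intro stepI[where as = "(Bit y, Move_Right) # idle (map scanned tps)"
          and ah = "(u (int (length xs)), Move_Right)" and ac = "(scanned ct, Stay)"])
       (simp_all add: map2_update_idle fun_upd_idem)
  from reach_step[OF this Cons.IH] show ?case by simp
qed

lemma reach_Copy:
  "reach (length ys)
     (Copy, (cells (w @ map Bit ys), int (length w)) # tps, (u, p), counter zs)
     (Copy, (cells (w @ replicate (length ys) Blank), int (length w + length ys)) # tps,
       (u, p + int (length ys)), counter (zs @ ys))"
proof (induction ys arbitrary: w p zs)
  case Nil
  show ?case by (simp add: reach_refl)
next
  case (Cons y ys)
  have "step (Copy, (cells (w @ map Bit (y # ys)), int (length w)) # tps, (u, p), counter zs)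
    (Copy, (cells ((w @ [Blank]) @ map Bit ys), int (length (w @ [Blank]))) # tps, (u, p + 1),
      counter (zs @ [y]))"
    using cells_end_update[of "map Bit zs" "Bit y"]
    by (intro stepI[where as = "(Blank, Move_Right) # idle (map scanned tps)"
          and ah = "(u p, Move_Right)" and ac = "(Bit y, Move_Right)"])
       (simp_all add: map2_update_idle cells_middle cells_middle_update)
  from reach_step[OF this Cons.IH] show ?case by (simp add: algebra_simps)
qed

text \<open>The input tape has no left marker. The history head moves in step with the input head
  throughout the preparation, so \<open>Sep\<close> in cell 0 of the history tape shows when both
  are back.\<close>

lemma reach_Return:
  "reach m (Return, (v, int m) # tps, ((\<lambda>_. Blank)(0 := Sep), int m), ct)
     (Return, (v, 0) # tps, ((\<lambda>_. Blank)(0 := Sep), 0), ct)"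
proof (induction m)
  case 0
  show ?case by (simp add: reach_refl)
next
  case (Suc m)
  have "step (Return, (v, int (Suc m)) # tps, ((\<lambda>_. Blank)(0 := Sep), int (Suc m)), ct)
    (Return, (v, int m) # tps, ((\<lambda>_. Blank)(0 := Sep), int m), ct)"
    by (intro stepI[where as = "(v (int (Suc m)), Move_Left) # idle (map scanned tps)"
          and ah = "(Blank, Move_Left)" and ac = "(scanned ct, Stay)"])
       (auto simp: map2_update_idle fun_eq_iff)
  from reach_step[OF this Suc.IH] show ?case .
qed

text \<open>Scanning, copying and returning take \<open>length x\<close>, \<open>length b\<close>
  and \<open>length x + 1 + length b\<close> steps; the four changes of phase account for the
  rest.\<close>

lemma reach_Down_start:
  "reach (2 * length x + 2 * length b + 5)
     (Init, (cells (map Bit x @ Sep # map Bit b), 0) # tps, (\<lambda>_. Blank, 0), (\<lambda>_. Blank, 0))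
     (Down (start M), (cells (map Bit x), 0) # tps, ((\<lambda>_. Blank)(0 := Sep), 1), counter b)"
proof -
  let ?n = "length x" and ?m = "length b"
  let ?u = "(\<lambda>_. Blank)(0 := Sep)" and ?e = "(\<lambda>_. Blank, 0)"
  have e: "?e = counter []" by (auto simp: cells_def)
  have s1: "step (Init, (cells (map Bit x @ Sep # map Bit b), 0) # tps, ?e, ?e)
    (Scan, (cells (map Bit x @ Sep # map Bit b), 0) # tps, (?u, 0), ?e)"
    by (rule stepI[OF act.simps(1)]) (simp_all only: map2_update_idle update_scanned_Stay, simp)
  have r1: "reach ?n (Scan, (cells (map Bit x @ Sep # map Bit b), 0) # tps, (?u, 0), ?e)
    (Scan, (cells (map Bit x @ Sep # map Bit b), int ?n) # tps, (?u, int ?n), ?e)"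
    using reach_Scan[of x "[]"] by simp
  have s2: "step (Scan, (cells (map Bit x @ Sep # map Bit b), int ?n) # tps, (?u, int ?n), ?e)
    (Copy, (cells ((map Bit x @ [Blank]) @ map Bit b), int (?n + 1)) # tps, (?u, int (?n + 1)), ?e)"
    using cells_middle[of "map Bit x"] cells_middle_update[of "map Bit x"]
    by (intro stepI[where as = "(Blank, Move_Right) # idle (map scanned tps)"
          and ah = "(?u (int ?n), Move_Right)" and ac = "(Blank, Stay)"])
       (auto simp: map2_update_idle fun_eq_iff)
  let ?v = "cells ((map Bit x @ [Blank]) @ replicate ?m Blank)"
  have r2: "reach ?m
    (Copy, (cells ((map Bit x @ [Blank]) @ map Bit b), int (?n + 1)) # tps, (?u, int (?n + 1)), ?e)
    (Copy, (?v, int (?n + 1 + ?m)) # tps, (?u, int (?n + 1 + ?m)), counter b)"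
    using reach_Copy[of b "map Bit x @ [Blank]" tps ?u "int (?n + 1)" "[]"] unfolding e
    by (simp add: add.assoc)
  have v: "?v = cells (map Bit x)"
    using cells_append_blanks[of "map Bit x" "Suc ?m"] by simp
  have "?v (int (?n + 1 + ?m)) = Blank" unfolding v by (simp add: cells_def)
  then have s3: "step (Copy, (?v, int (?n + 1 + ?m)) # tps, (?u, int (?n + 1 + ?m)), counter b)
    (Return, (?v, int (?n + 1 + ?m)) # tps, (?u, int (?n + 1 + ?m)), counter b)"
    by (intro stepI[where as = "idle (map scanned ((?v, int (?n + 1 + ?m)) # tps))"
          and ah = "(scanned (?u, int (?n + 1 + ?m)), Stay)" and ac = "(scanned (counter b), Stay)"])
       (simp_all only: map2_update_idle update_scanned_Stay, simp)
  have r3: "reach (?n + 1 + ?m)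
    (Return, (?v, int (?n + 1 + ?m)) # tps, (?u, int (?n + 1 + ?m)), counter b)
    (Return, (?v, 0) # tps, (?u, 0), counter b)"
    by (rule reach_Return)
  have s4: "step (Return, (?v, 0) # tps, (?u, 0), counter b)
    (Down (start M), (?v, 0) # tps, (?u, 1), counter b)"
    by (intro stepI[where as = "idle (map scanned ((?v, 0) # tps))"
          and ah = "(Sep, Move_Right)" and ac = "(scanned (counter b), Stay)"])
       (simp_all only: map2_update_idle update_scanned_Stay, simp_all)
  have "reach (Suc (?n + Suc (?m + Suc (?n + 1 + ?m + Suc 0))))
     (Init, (cells (map Bit x @ Sep # map Bit b), 0) # tps, ?e, ?e)
     (Down (start M), (?v, 0) # tps, (?u, 1), counter b)"
    by (intro reach_step[OF s1] reach_trans[OF r1] reach_step[OF s2] reach_trans[OF r2]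
        reach_step[OF s3] reach_trans[OF r3] reach_step[OF s4] reach_refl)
  then show ?thesis unfolding v by (rule reach_mono) simp
qed

lemma initial_eq:
  "initial M w = (start M, (cells w, 0) # replicate (ntapes M - 1) (\<lambda>_. Blank, 0))"
  by (simp add: initial_def cells_def)

lemma initial_machine:
  "initial machine w = (to_nat Init,
     mix ((cells w, 0) # replicate (ntapes M - 1) (\<lambda>_. Blank, 0)) (\<lambda>_. Blank, 0) (\<lambda>_. Blank, 0))"
proof -
  obtain k where "ntapes M = Suc k" using wf by (cases "ntapes M") (auto simp: wf_tm_def)
  then show ?thesis by (simp add: initial_def machine_def cells_def mix_def)
qed

text \<open>\<open>d\<close> enters only the time bound. A counter starting at \<open>m\<close> pays
  for \<open>m + 1\<close> leaves, whence the threshold; the 7 is the 5 of the preparation plus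
  \<open>Back\<close> and \<open>Pop\<close> at the bottom of the stack.\<close>

lemma machine_decides:
  assumes "depth_le M (initial M (map Bit x)) d"
  shows "\<exists>ts q tps. run machine (initial machine (encode_pair x m)) ts (q, tps) \<and>
    halted machine (q, tps) \<and>
    length ts \<le> 2 * length x + 2 * length (binary m) + 7 +
      (m + 1) * ((2 * length (binary m) + 7) * d + 1) \<and>
    (q \<in> accepting machine \<longleftrightarrow> leaves M (initial M (map Bit x)) \<le> m + 1)"
proof -
  let ?b = "binary m" and ?u = "(\<lambda>_. Blank)(0 := Sep)" and ?e = "(\<lambda>_. Blank, 0)"
  let ?r = "replicate (ntapes M - 1) ?e"
  let ?in = "(cells (map Bit x @ Sep # map Bit ?b), 0) # ?r"
  let ?tps = "(cells (map Bit x), 0) # ?r" and ?K = "(2 * length ?b + 7) * d + 1"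
  let ?T = "2 * length x + 2 * length ?b + 7 + (m + 1) * ?K"
  let ?L = "leaves M (initial M (map Bit x))"
  have len: "length ?tps = ntapes M" using wf by (simp add: wf_tm_def)
  note start = reach_Down_start[of x ?b ?r]
  have "traverses ?L ?K (Down (start M)) ?tps (?u, 1) ?b"
    unfolding initial_eq by (rule traverses_Down) (use assms len in \<open>simp_all add: initial_eq\<close>)
  then have "\<exists>q c. reach ?T (Init, ?in, ?e, ?e) (q, c) \<and>
    (q = Accept \<and> ?L \<le> m + 1 \<or> q = Reject \<and> m + 1 < ?L)"
  proof (cases rule: traverses_cases)
    case (1 bs)
    then have le: "?L \<le> m + 1" by (simp add: bits_val_binary)
    have s1: "step (Back, ?tps, (?u, 1), counter bs) (Pop, ?tps, (?u, 0), counter bs)"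
      by (rule stepI[OF act.simps(7)])
         (simp_all only: map2_update_idle update_scanned_Stay, simp add: fun_eq_iff)
    have s2: "step (Pop, ?tps, (?u, 0), counter bs) (Accept, ?tps, (?u, 0), counter bs)"
      by (intro stepI[where as = "idle (map scanned ?tps)" and ah = "(scanned (?u, 0), Stay)"
            and ac = "(scanned (counter bs), Stay)"])
         (simp_all only: map2_update_idle update_scanned_Stay, simp)
    have "reach (2 * length x + 2 * length ?b + 5 + (?L * ?K + Suc (Suc 0)))
      (Init, ?in, ?e, ?e) (Accept, ?tps, (?u, 0), counter bs)"
      by (intro reach_trans[OF start] reach_trans[OF 1(3)]
          reach_step[OF s1] reach_step[OF s2] reach_refl)
    then have "reach ?T (Init, ?in, ?e, ?e) (Accept, ?tps, (?u, 0), counter bs)"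
      by (rule reach_mono) (use mult_le_mono1[OF le, of ?K] in linarith)
    with le show ?thesis by blast
  next
    case (2 c)
    from reach_trans[OF start 2(2)] have "reach ?T (Init, ?in, ?e, ?e) (Reject, c)"
      by (rule reach_mono) (simp add: bits_val_binary)
    with 2(1) show ?thesis unfolding bits_val_binary by blast
  qed
  then obtain q tps ht ct k where k: "k \<le> ?T" "(step ^^ k) (Init, ?in, ?e, ?e) (q, tps, ht, ct)"
    and q: "q = Accept \<and> ?L \<le> m + 1 \<or> q = Reject \<and> m + 1 < ?L"
    unfolding reach_def by (metis prod_cases4)
  have base: "Blank \<in> symbols" "Bit c \<in> symbols" "Sep \<in> symbols" for c
    using wf by (cases c; auto simp: symbols_def wf_tm_def)+
  have "set w \<subseteq> symbols \<Longrightarrow> range (cells w) \<subseteq> symbols" for w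
    using base(1) nth_mem by (fastforce simp: cells_def)
  moreover have "set (map Bit x @ Sep # map Bit ?b) \<subseteq> symbols" using base by auto
  ultimately have inp: "range (cells (map Bit x @ Sep # map Bit ?b)) \<subseteq> symbols" by blast
  have "\<exists>ts. length ts = k \<and> run machine (to_nat Init, mix ?in ?e ?e) ts (to_nat q, mix tps ht ct)"
  proof (rule run_machine[OF k(2)])
    show "Init \<in> dstates" by (simp add: dstates_def)
    show "length ?in = ntapes M" using len by simp
    show "range (fst tp) \<subseteq> symbols" if "tp \<in> set ?in \<union> {?e, ?e}" for tp
      using that inp base(1) by auto
  qed
  then obtain ts where ts: "length ts = k"
    "run machine (initial machine (encode_pair x m)) ts (to_nat q, mix tps ht ct)"
    by (auto simp: initial_machine encode_pair_def)
  have "halted machine (to_nat q, mix tps ht ct)" using q by (intro halted_machine) auto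
  moreover have "to_nat q \<in> accepting machine \<longleftrightarrow> ?L \<le> m + 1"
    using q by (auto simp: machine_def)
  ultimately show ?thesis using ts k(1) by blast
qed

end

section \<open>Conclusion and asymptotic estimate\<close>

theorem theorem2:
  fixes f :: "bool list \<Rightarrow> nat" and s :: "nat \<Rightarrow> nat"
  assumes "f \<in> TotP"
    and "\<And>n. s n > 0"
    and "(\<lambda>n. real (s n)) \<in> O(\<lambda>n. 2 ^ n)"
  shows "\<exists>(D :: tm) (T :: nat \<Rightarrow> nat) (p :: nat poly).
           decides_within D
             (\<lambda>x. encode_pair x (s (length x)))
             (\<lambda>x. f x \<le> s (length x))
             (\<lambda>x. T (length x)) \<and>
           (\<lambda>n. real (T n)) \<in> O(\<lambda>n. real (s n) * real (poly p n))"
proof -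
  from assms(1) obtain M p where wf: "wf_tm M"
    and p: "\<And>x ts c. run M (initial M (map Bit x)) ts c \<Longrightarrow> length ts \<le> poly p (length x)"
    and f: "\<And>x. card (computation_paths M (map Bit x)) = f x + 1"
    unfolding TotP_def poly_time_def by blast
  obtain trs where "set trs = transitions M" "distinct trs"
    using finite_distinct_list[OF finite_transitions[OF wf]] by blast
  then interpret path_search M trs using wf by unfold_locales
  define b where "b n = length (binary (s n))" for n
  \<comment> \<open>The actual width \<open>b n\<close> makes \<open>T\<close> valid for every
    input; the estimate of \<open>b n\<close> below holds only for large \<open>n\<close>.\<close>
  define T where "T n = 2 * n + 2 * b n + 7 + (s n + 1) * ((2 * b n + 7) * poly p n + 1)" for n
  have "leaves M (initial M (map Bit x)) = f x + 1" for x
    using f[of x] by (simp add: leaves_def paths_from_def computation_paths_def)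
  moreover have "depth_le M (initial M (map Bit x)) (poly p (length x))" for x
    using p by (auto simp: depth_le_def)
  ultimately have "\<exists>ts q tps. run machine (initial machine (encode_pair x (s (length x)))) ts (q, tps) \<and>
      halted machine (q, tps) \<and> length ts \<le> T (length x) \<and>
      (q \<in> accepting machine \<longleftrightarrow> f x \<le> s (length x))" for x
    using machine_decides[of x "poly p (length x)" "s (length x)"]
    unfolding T_def b_def by (simp only: add_le_cancel_right)
  then have "decides_within machine (\<lambda>x. encode_pair x (s (length x)))
      (\<lambda>x. f x \<le> s (length x)) (\<lambda>x. T (length x))"
    unfolding decides_within_def using wf_machine deterministic_machine by blast
  moreover
  from assms(3) obtain C where C: "eventually (\<lambda>n. real (s n) \<le> C * 2 ^ n) at_top"
    by (auto elim!: landau_o.bigE)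
  \<comment> \<open>Since \<open>C \<le> c \<le> 2 ^ c\<close>, the constant of the O-bound costs
    \<open>c\<close> extra bits; the further bit in \<open>b_le\<close> stems from the factor 2 in
    \<open>length_binary\<close>.\<close>
  define c where "c = nat \<lceil>C\<rceil>"
  have b_le: "b n \<le> n + c + 1" if "real (s n) \<le> C * 2 ^ n" for n
  proof -
    have "C \<le> real c" unfolding c_def by (rule real_nat_ceiling_ge)
    also have "\<dots> \<le> real (2 ^ c)" by (intro of_nat_mono less_imp_le less_exp)
    finally have "C * 2 ^ n \<le> real (2 ^ c) * 2 ^ n" by (intro mult_right_mono) auto
    with that have "real (s n) \<le> real (2 ^ c) * 2 ^ n" by (rule order_trans)
    then have "real (s n) \<le> real (2 ^ c * 2 ^ n)" by simp
    then have "s n \<le> 2 ^ c * 2 ^ n" by (simp only: of_nat_le_iff)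
    then have "2 ^ b n \<le> 2 * (2 ^ c * 2 ^ n :: nat)"
      using length_binary[OF assms(2), of n] unfolding b_def by linarith
    also have "\<dots> = 2 ^ (n + c + 1)" by (simp add: power_add)
    finally show ?thesis by (rule power_le_imp_le_exp[rotated]) simp
  qed
  \<comment> \<open>With \<open>b n \<le> n + c + 1\<close>, the preparation is at most
    \<open>4 * n + 2 * c + 9\<close> and the factor \<open>2 * b n + 7\<close> at most
    \<open>2 * n + 2 * c + 9\<close>; the factor 2 comes from \<open>s n + 1 \<le> 2 * s n\<close>,
    by positivity.\<close>
  define P where "P = [:2 * c + 9, 4:] + [:2:] * ([:2 * c + 9, 2:] * p + 1)"
  have T_le: "T n \<le> s n * poly P n" if "b n \<le> n + c + 1" for n
  proof -
    have s: "s n \<ge> 1" using assms(2)[of n] by simp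
    have "2 * n + 2 * b n + 7 \<le> 1 * (2 * c + 9 + 4 * n)" using that by simp
    also have "\<dots> \<le> s n * (2 * c + 9 + 4 * n)" using s by (rule mult_le_mono1)
    finally have "2 * n + 2 * b n + 7 \<le> s n * (2 * c + 9 + 4 * n)" .
    moreover have "(s n + 1) * ((2 * b n + 7) * poly p n + 1) \<le>
        (s n * 2) * ((2 * c + 9 + 2 * n) * poly p n + 1)"
    proof (rule mult_le_mono)
      show "s n + 1 \<le> s n * 2" using s by simp
      show "(2 * b n + 7) * poly p n + 1 \<le> (2 * c + 9 + 2 * n) * poly p n + 1"
        using that by (intro add_le_mono1 mult_le_mono1) simp
    qed
    ultimately show ?thesis by (simp add: T_def P_def algebra_simps)
  qed
  have "eventually (\<lambda>n. norm (real (T n)) \<le> 1 * norm (real (s n) * real (poly P n))) at_top"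
    using C
  proof eventually_elim
    case (elim n)
    from T_le[OF b_le[OF elim]] have "real (T n) \<le> real (s n * poly P n)" by (simp only: of_nat_le_iff)
    then show ?case by simp
  qed
  then have "(\<lambda>n. real (T n)) \<in> O(\<lambda>n. real (s n) * real (poly P n))" by (rule bigoI)
  ultimately show ?thesis by blast
qed

end
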